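(* Let $(L,\tau)$ be an ordered topological vector space (in particular, $(L,\tau)$ may be a locally solid Riesz space) that has an order bounded $\tau$-neighborhood of zero. Then every $\tau$-bounded subset of $L$ is order bounded.
   Context: Vector spaces are real. An ordered vector space is a real vector space with a partial order such that $x\le y$ implies $x+z\le y+z$ for all $z$ and $\alpha x\le\alpha y$ for all $\alpha\ge 0$. An ordered topological vector space is an ordered vector space equipped with a vector topology (one making addition and scalar multiplication continuous; not assumed Hausdorff). A Riesz space is an ordered vector space that is a lattice; a subset $Y$ of a Riesz space is solid if $|x|\le|y|$ and $y\in Y$ imply $x\in Y$; a locally solid Riesz space is a Riesz space with a vector topology having a neighborhood base at zero consisting of solid sets. A subset is order bounded if it is contained in some order interval $[u,v]=\{x: u\le x\le v\}$. A subset $A$ is $\tau$-bounded if for every $\tau$-neighborhood $V$ of zero there is some $\lambda>0$ with $\lambda A\subset V$. *)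

theory Defs
  imports Complex_Main
begin

definition (in topological_space) nbhd_of :: "'a \<Rightarrow> 'a set \<Rightarrow> bool" where
  "nbhd_of x V \<longleftrightarrow> (\<exists>U. open U \<and> x \<in> U \<and> U \<subseteq> V)"

text \<open>
  Real topological vector spaces, not assumed Hausdorff. Joint continuity of addition is the
  axiom of \<^class>\<open>topological_comm_monoid_add\<close>, and joint continuity of scalar multiplication
  is stated in the same form.
\<close>

class topological_real_vector = real_vector + topological_comm_monoid_add +
  assumes tendsto_scaleR_Pair:
    "LIM p (nhds (c::real) \<times>\<^sub>F nhds x). fst p *\<^sub>R snd p :> nhds (c *\<^sub>R x)"

text \<open>No compatibility between order and topology is required.\<close>

class ordered_topological_vector = ordered_real_vector + topological_real_vector

class riesz_space = ordered_real_vector + lattice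
begin

text \<open>In a Riesz space the absolute value of \<open>x\<close> is \<open>sup x (- x)\<close>.\<close>

definition solid :: "'a set \<Rightarrow> bool" where
  "solid Y \<longleftrightarrow> (\<forall>x y. sup x (- x) \<le> sup y (- y) \<and> y \<in> Y \<longrightarrow> x \<in> Y)"

end

text \<open>
  Locally solid Riesz spaces form a subclass of \<^class>\<open>ordered_topological_vector\<close>, so results
  for the latter specialise to them.
\<close>

class locally_solid_riesz_space = riesz_space + ordered_topological_vector +
  assumes solid_nbhd_base: "nbhd_of 0 V \<Longrightarrow> \<exists>W. nbhd_of 0 W \<and> solid W \<and> W \<subseteq> V"

definition order_bounded :: "'a::order set \<Rightarrow> bool" where
  "order_bounded A \<longleftrightarrow> (\<exists>u v. A \<subseteq> {u..v})"

definition topologically_bounded :: "'a::topological_real_vector set \<Rightarrow> bool" where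
  "topologically_bounded A \<longleftrightarrow>
     (\<forall>V. nbhd_of 0 V \<longrightarrow> (\<exists>c::real. c > 0 \<and> (\<lambda>x. c *\<^sub>R x) ` A \<subseteq> V))"

end

theory Submission
  imports Defs
begin

text \<open>Boundedness of \<open>A\<close>, tested against the one order bounded neighborhood
  \<open>V\<close> of zero, shrinks \<open>A\<close> into \<open>V\<close> by a scalar
  \<open>c > 0\<close>. The shrunken copy then lies in an order interval, and dilating by
  \<open>inverse c\<close> recovers \<open>A\<close> and carries that interval into another one. The
  order enters through \<open>order_bounded_scaleR_image\<close>.\<close>

lemma order_bounded_subset:
  assumes "order_bounded B" and "A \<subseteq> B"
  shows "order_bounded A"
  using assms unfolding order_bounded_def by (meson order_trans)

text \<open>Multiplication by a nonnegative scalar is monotone, so scaling the endpoints of an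
  interval around \<open>A\<close> gives an interval around the image.\<close>

lemma order_bounded_scaleR_image:
  fixes A :: "'a::ordered_real_vector set"
  assumes "order_bounded A" and "c \<ge> 0"
  shows "order_bounded ((\<lambda>x. c *\<^sub>R x) ` A)"
proof -
  obtain u v where "A \<subseteq> {u..v}"
    using assms(1) unfolding order_bounded_def by blast
  then have "(\<lambda>x. c *\<^sub>R x) ` A \<subseteq> {c *\<^sub>R u..c *\<^sub>R v}"
    using assms(2) by (auto intro!: scaleR_left_mono)
  then show ?thesis
    unfolding order_bounded_def by blast
qed

theorem theorem2p2:
  fixes A :: "'a::ordered_topological_vector set"
  assumes "\<exists>V :: 'a set. nbhd_of 0 V \<and> order_bounded V"
    and "topologically_bounded A"
  shows "order_bounded A"
proof -
  obtain V :: "'a set" where V: "nbhd_of 0 V" "order_bounded V"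
    using assms(1) by blast
  obtain c :: real where c: "c > 0" "(\<lambda>x. c *\<^sub>R x) ` A \<subseteq> V"
    using assms(2) V(1) unfolding topologically_bounded_def by blast
  have "order_bounded ((\<lambda>x. inverse c *\<^sub>R x) ` (\<lambda>x. c *\<^sub>R x) ` A)"
    using c(1) by (intro order_bounded_scaleR_image order_bounded_subset[OF V(2) c(2)]) simp
  moreover have "(\<lambda>x. inverse c *\<^sub>R x) ` (\<lambda>x. c *\<^sub>R x) ` A = A"
    using c(1) unfolding image_image by simp
  ultimately show ?thesis
    by metis
qed

end
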